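(* In the special case $\gamma=0$ of the scheduling problem of minimizing the total cost $c(\mathbf a)$ over arrival vectors $\mathbf a$, there is an algorithm running in time polynomial in $N$ that finds the unique optimal schedule $\mathbf a^0$, and this schedule achieves $c(\mathbf a^0)=0$.
   Context: $N\ge1$ is an integer, $\mathcal N=\{1,\dots,N\}$, and $\alpha,\beta>0$ satisfy $N<\beta/\alpha+1$. For an arrival vector $\mathbf a=(a_1,\dots,a_N)'\in\mathbb R^N$, the departure vector $\mathbf d(\mathbf a)=(d_1(\mathbf a),\dots,d_N(\mathbf a))'$ is the unique $\mathbf d$ with $a_i\le d_i$ satisfying $$1=\int_{a_i}^{d_i}\Big[\beta-\alpha\Big(\sum_{j=1}^N \mathbf 1\{t\in[a_j,d_j]\}-1\Big)\Big]dt,\qquad i\in\mathcal N.$$ Given ideal departure times $d_1^*\le\dots\le d_N^*$ and a weight $\gamma\ge0$, the total cost is $$c(\mathbf a)=\sum_{i=1}^N\Big[(d_i(\mathbf a)-d_i^* )^2+\gamma\,(d_i(\mathbf a)-a_i)\Big].$$ Running time is measured in the number of arithmetic operations and comparisons on real numbers; the input consists of $N,\alpha,\beta$ and $d_1^*,\dots,d_N^*$. *)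

theory Defs
  imports "HOL-Analysis.Analysis" "HOL-Computational_Algebra.Polynomial"
begin

section \<open>The scheduling problem\<close>

text \<open>The dimension \<open>N\<close> is an input of the algorithm, so vectors in \<open>\<real>\<^sup>N\<close> are represented by
  functions on \<open>{1..N}\<close>, made extensional so that equality is equality of vectors.\<close>

definition rvec :: "nat \<Rightarrow> (nat \<Rightarrow> real) set" where
  "rvec N = {1..N} \<rightarrow>\<^sub>E UNIV"

definition is_departure ::
    "nat \<Rightarrow> real \<Rightarrow> real \<Rightarrow> (nat \<Rightarrow> real) \<Rightarrow> (nat \<Rightarrow> real) \<Rightarrow> bool" where
  "is_departure N \<alpha> \<beta> a d \<longleftrightarrow>
     d \<in> rvec N \<and>
     (\<forall>i\<in>{1..N}. a i \<le> d i \<and>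
        ((\<lambda>t. \<beta> - \<alpha> * ((\<Sum>j=1..N. indicator {a j..d j} t) - 1)) has_integral 1) {a i..d i})"

definition departure :: "nat \<Rightarrow> real \<Rightarrow> real \<Rightarrow> (nat \<Rightarrow> real) \<Rightarrow> (nat \<Rightarrow> real)" where
  "departure N \<alpha> \<beta> a = (THE d. is_departure N \<alpha> \<beta> a d)"

definition total_cost ::
    "nat \<Rightarrow> real \<Rightarrow> real \<Rightarrow> real \<Rightarrow> (nat \<Rightarrow> real) \<Rightarrow> (nat \<Rightarrow> real) \<Rightarrow> real" where
  "total_cost N \<alpha> \<beta> \<gamma> dstar a =
     (\<Sum>i=1..N. (departure N \<alpha> \<beta> a i - dstar i)\<^sup>2 + \<gamma> * (departure N \<alpha> \<beta> a i - a i))"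

definition optimal_schedule ::
    "nat \<Rightarrow> real \<Rightarrow> real \<Rightarrow> real \<Rightarrow> (nat \<Rightarrow> real) \<Rightarrow> (nat \<Rightarrow> real) \<Rightarrow> bool" where
  "optimal_schedule N \<alpha> \<beta> \<gamma> dstar a \<longleftrightarrow>
     is_arg_min (total_cost N \<alpha> \<beta> \<gamma> dstar) (\<lambda>b. b \<in> rvec N) a"

section \<open>Algorithms over the reals\<close>

text \<open>A structured real RAM. There are finitely many natural-number index variables and finitely
  many arrays of reals in a program, both named by natural numbers; a real operand \<open>(A, x)\<close> is the
  cell of the array \<open>A\<close> at the current value of the index variable \<open>x\<close>. The only real constants
  are 0 and 1, and there is no rounding or any other conversion from reals to indices: reals
  influence the control flow only through comparisons. Index variables can be set to a
  constant, copied, incremented, decremented and compared.\<close>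

record state =
  idx :: "nat \<Rightarrow> nat"
  arr :: "nat \<Rightarrow> nat \<Rightarrow> real"

type_synonym operand = "nat \<times> nat"

datatype arith_op = Plus | Minus | Times | Divide

datatype comparison = RLess operand operand | ILess nat nat

datatype prog =
    Skip
  | ISet nat nat
  | ICopy nat nat
  | ISuc nat
  | IPred nat
  | RZero operand
  | ROne operand
  | RCopy operand operand
  | RArith operand arith_op operand operand
  | Seq prog prog
  | Cond comparison prog prog
  | Loop comparison prog

fun rd :: "state \<Rightarrow> operand \<Rightarrow> real" where
  "rd s (A, x) = arr s A (idx s x)"

fun wr :: "operand \<Rightarrow> real \<Rightarrow> state \<Rightarrow> state" where
  "wr (A, x) v s = s\<lparr>arr := (arr s)(A := (arr s A)(idx s x := v))\<rparr>"

definition set_idx :: "nat \<Rightarrow> nat \<Rightarrow> state \<Rightarrow> state" where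
  "set_idx x n s = s\<lparr>idx := (idx s)(x := n)\<rparr>"

fun apply_op :: "arith_op \<Rightarrow> real \<Rightarrow> real \<Rightarrow> real" where
  "apply_op Plus u v = u + v"
| "apply_op Minus u v = u - v"
| "apply_op Times u v = u * v"
| "apply_op Divide u v = u / v"

fun holds :: "comparison \<Rightarrow> state \<Rightarrow> bool" where
  "holds (RLess p q) s \<longleftrightarrow> rd s p < rd s q"
| "holds (ILess x y) s \<longleftrightarrow> idx s x < idx s y"

text \<open>\<open>exec c s T s'\<close>: started in \<open>s\<close>, the program \<open>c\<close> terminates in \<open>s'\<close> after \<open>T\<close> operations.
  Besides the arithmetic operations and comparisons on reals, \<open>T\<close> also counts data movement and
  all operations on index variables. A division by zero gets stuck.\<close>

inductive exec :: "prog \<Rightarrow> state \<Rightarrow> nat \<Rightarrow> state \<Rightarrow> bool" where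
  Skip: "exec Skip s 0 s"
| ISet: "exec (ISet x n) s 1 (set_idx x n s)"
| ICopy: "exec (ICopy x y) s 1 (set_idx x (idx s y) s)"
| ISuc: "exec (ISuc x) s 1 (set_idx x (idx s x + 1) s)"
| IPred: "exec (IPred x) s 1 (set_idx x (idx s x - 1) s)"
| RZero: "exec (RZero p) s 1 (wr p 0 s)"
| ROne: "exec (ROne p) s 1 (wr p 1 s)"
| RCopy: "exec (RCopy p q) s 1 (wr p (rd s q) s)"
| RArith: "(f = Divide \<Longrightarrow> rd s r \<noteq> 0) \<Longrightarrow>
    exec (RArith p f q r) s 1 (wr p (apply_op f (rd s q) (rd s r)) s)"
| Seq: "exec c1 s T1 s1 \<Longrightarrow> exec c2 s1 T2 s2 \<Longrightarrow> exec (Seq c1 c2) s (T1 + T2) s2"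
| CondT: "holds b s \<Longrightarrow> exec c1 s T s1 \<Longrightarrow> exec (Cond b c1 c2) s (1 + T) s1"
| CondF: "\<not> holds b s \<Longrightarrow> exec c2 s T s1 \<Longrightarrow> exec (Cond b c1 c2) s (1 + T) s1"
| LoopF: "\<not> holds b s \<Longrightarrow> exec (Loop b c) s 1 s"
| LoopT: "holds b s \<Longrightarrow> exec c s T1 s1 \<Longrightarrow> exec (Loop b c) s1 T2 s2 \<Longrightarrow>
    exec (Loop b c) s (1 + T1 + T2) s2"

inductive_cases exec_SkipE: "exec Skip s T s'"
inductive_cases exec_ISetE: "exec (ISet x n) s T s'"
inductive_cases exec_ICopyE: "exec (ICopy x y) s T s'"
inductive_cases exec_ISucE: "exec (ISuc x) s T s'"
inductive_cases exec_IPredE: "exec (IPred x) s T s'"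
inductive_cases exec_RZeroE: "exec (RZero p) s T s'"
inductive_cases exec_ROneE: "exec (ROne p) s T s'"
inductive_cases exec_RCopyE: "exec (RCopy p q) s T s'"
inductive_cases exec_RArithE: "exec (RArith p f q r) s T s'"
inductive_cases exec_SeqE: "exec (Seq c1 c2) s T s'"
inductive_cases exec_CondE: "exec (Cond b c1 c2) s T s'"
inductive_cases exec_LoopE: "exec (Loop b c) s T s'"

lemma exec_deterministic:
  "exec c s T s1 \<Longrightarrow> exec c s U s2 \<Longrightarrow> U = T \<and> s2 = s1"
proof (induction arbitrary: U s2 rule: exec.induct)
  case Skip
  then show ?case by (rule exec_SkipE) simp
next
  case ISet
  then show ?case by (rule exec_ISetE) simp
next
  case ICopy
  then show ?case by (rule exec_ICopyE) simp
next
  case ISuc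
  then show ?case by (rule exec_ISucE) simp
next
  case IPred
  then show ?case by (rule exec_IPredE) simp
next
  case RZero
  then show ?case by (rule exec_RZeroE) simp
next
  case ROne
  then show ?case by (rule exec_ROneE) simp
next
  case RCopy
  then show ?case by (rule exec_RCopyE) simp
next
  case RArith
  from RArith.prems show ?case by (rule exec_RArithE) simp
next
  case (Seq c1 s T1 s1 c2 T2 s2')
  from Seq.prems obtain V1 t1 V2 where
    1: "U = V1 + V2" "exec c1 s V1 t1" "exec c2 t1 V2 s2"
    by (rule exec_SeqE)
  have 2: "V1 = T1" "t1 = s1"
    using Seq.IH(1)[OF 1(2)] by blast+
  with Seq.IH(2)[of V2 s2] 1 show ?case by blast
next
  case (CondT b s c1 T s1 c2)
  from CondT.prems CondT.hyps obtain V where "U = Suc V" "exec c1 s V s2"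
    by (rule_tac exec_CondE) blast+
  with CondT.IH[of V s2] show ?case by (metis plus_1_eq_Suc)
next
  case (CondF b s c2 T s1 c1)
  from CondF.prems CondF.hyps obtain V where "U = Suc V" "exec c2 s V s2"
    by (rule_tac exec_CondE) blast+
  with CondF.IH[of V s2] show ?case by (metis plus_1_eq_Suc)
next
  case (LoopF b s c)
  from LoopF.prems show ?case
    by (rule exec_LoopE) (use LoopF.hyps in simp_all)
next
  case (LoopT b s c T1 s1 T2 s2')
  from LoopT.prems LoopT.hyps obtain V1 t1 V2 where
    1: "U = Suc (V1 + V2)" "exec c s V1 t1" "exec (Loop b c) t1 V2 s2"
    by (rule_tac exec_LoopE) blast+
  have 2: "V1 = T1" "t1 = s1"
    using LoopT.IH(1)[OF 1(2)] by blast+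
  have "V2 = T2 \<and> s2 = s2'"
    using LoopT.IH(2)[of V2 s2] 1(3) 2 by blast
  with 1(1) 2 show ?case by simp
qed

text \<open>Input convention: \<open>N\<close> in index variable 0, \<open>\<alpha>\<close> and \<open>\<beta>\<close> in cells 0 and 1 of array 0, and
  \<open>dstar i\<close> in cell \<open>i\<close> of array 1; everything else is 0. The output vector is read from
  cells \<open>1..N\<close> of array 2.\<close>

definition input_state :: "nat \<Rightarrow> real \<Rightarrow> real \<Rightarrow> (nat \<Rightarrow> real) \<Rightarrow> state" where
  "input_state N \<alpha> \<beta> dstar =
     \<lparr>idx = (\<lambda>x. 0)(0 := N),
      arr = (\<lambda>A k. 0)
        (0 := (\<lambda>k. 0)(0 := \<alpha>, 1 := \<beta>),
         1 := (\<lambda>k. if k \<in> {1..N} then dstar k else 0))\<rparr>"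

definition output_vec :: "nat \<Rightarrow> state \<Rightarrow> (nat \<Rightarrow> real)" where
  "output_vec N s = restrict (arr s 2) {1..N}"

end

theory Submission
  imports Defs
begin

text \<open>Integrating the indicators turns the departure condition into
  \<open>\<beta> (d\<^sub>i - a\<^sub>i) - \<alpha> \<Sum>\<^bsub>j\<noteq>i\<^esub> |[a\<^sub>i, d\<^sub>i] \<inter> [a\<^sub>j, d\<^sub>j]| = 1\<close>. Since the service rate stays
  positive, users depart in their order of arrival. For fixed sorted \<open>d\<close> the equation of user \<open>i\<close>
  therefore involves only \<open>a\<^sub>i\<close> and the later arrivals, and reads \<open>\<beta> x + \<alpha> \<Sum>\<^bsub>j<i\<^esub> (d\<^sub>j - x)\<^sup>+ = c\<close>
  with \<open>x = a\<^sub>i\<close>. The left-hand side is an increasing maximum of at most \<open>i\<close> lines, so the solution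
  is the smallest root of these lines, and backward substitution takes \<open>O(N\<^sup>2)\<close> operations.
  As the equations are invariant under time reversal, every arrival vector also has exactly one
  departure vector; hence cost 0 characterizes the arrival vectors with departures \<open>dstar\<close>.\<close>

section \<open>Departures as solutions of a piecewise linear system\<close>

definition overlap :: "('i \<Rightarrow> real) \<Rightarrow> ('i \<Rightarrow> real) \<Rightarrow> 'i \<Rightarrow> 'i \<Rightarrow> real" where
  "overlap a d i j = max 0 (min (d i) (d j) - max (a i) (a j))"

text \<open>The index set is arbitrary and nothing is required outside it, so time reversal and
  relabelling of users act on this condition directly. The extensionality in \<open>rvec\<close>
  stays with \<open>is_departure\<close>.\<close>

definition balanced :: "'i set \<Rightarrow> real \<Rightarrow> real \<Rightarrow> ('i \<Rightarrow> real) \<Rightarrow> ('i \<Rightarrow> real) \<Rightarrow> bool" where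
  "balanced S \<alpha> \<beta> a d \<longleftrightarrow>
     (\<forall>i\<in>S. a i \<le> d i \<and> \<beta> * (d i - a i) - \<alpha> * (\<Sum>j\<in>S - {i}. overlap a d i j) = 1)"

lemma has_integral_indicator_Icc:
  fixes p q x y :: real
  shows "((\<lambda>t. indicator {p..q} t :: real) has_integral max 0 (min y q - max x p)) {x..y}"
proof -
  have "((\<lambda>t. 1 :: real) has_integral max 0 (min y q - max x p)) ({p..q} \<inter> {x..y})"
    using has_integral_const_real[of "1::real" "max p x" "min q y"]
    by (simp add: Int_atLeastAtMost max.commute min.commute max_def min_def split: if_splits)
  moreover have "indicator {p..q} = (\<lambda>t. if t \<in> {p..q} then 1 else 0 :: real)"
    by (auto simp: indicator_def)
  ultimately show ?thesis
    by (simp only: has_integral_restrict_Int)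
qed

lemma is_departure_iff_balanced:
  "is_departure N \<alpha> \<beta> a d \<longleftrightarrow> d \<in> rvec N \<and> balanced {1..N} \<alpha> \<beta> a d"
proof -
  have "((\<lambda>t. \<beta> - \<alpha> * ((\<Sum>j=1..N. indicator {a j..d j} t) - 1)) has_integral 1) {a i..d i}
      \<longleftrightarrow> \<beta> * (d i - a i) - \<alpha> * (\<Sum>j\<in>{1..N} - {i}. overlap a d i j) = 1"
    if i: "i \<in> {1..N}" and le: "a i \<le> d i" for i
  proof -
    let ?f = "\<lambda>t. \<beta> - \<alpha> * ((\<Sum>j=1..N. indicator {a j..d j} t) - 1)"
    have const: "((\<lambda>t. r) has_integral r * (d i - a i)) {a i..d i}" for r :: real
      using has_integral_const_real[of r "a i" "d i"] le by (simp add: mult.commute)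
    have "(?f has_integral
        \<beta> * (d i - a i) - \<alpha> * ((\<Sum>j=1..N. overlap a d i j) - 1 * (d i - a i))) {a i..d i}"
      unfolding overlap_def
      by (intro has_integral_diff has_integral_mult_right const has_integral_sum
          has_integral_indicator_Icc) auto
    \<comment> \<open>User i overlaps itself for the whole time \<open>d i - a i\<close>, which
      cancels the \<open>- 1\<close> in the service rate.\<close>
    moreover have "(\<Sum>j=1..N. overlap a d i j)
        = (d i - a i) + (\<Sum>j\<in>{1..N} - {i}. overlap a d i j)"
      using i le by (subst sum.remove[of _ i]) (auto simp: overlap_def)
    ultimately have int: "(?f has_integral
        \<beta> * (d i - a i) - \<alpha> * (\<Sum>j\<in>{1..N} - {i}. overlap a d i j)) {a i..d i}"
      by simp
    show ?thesis
      using int has_integral_unique[OF int, of 1] by auto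
  qed
  then show ?thesis
    unfolding is_departure_def balanced_def by blast
qed

section \<open>Order of departures and uniqueness\<close>

lemma overlap_commute: "overlap a d i j = overlap a d j i"
  by (simp add: overlap_def min.commute max.commute)

text \<open>If j arrived before i but left no earlier, its stay would be longer by some \<delta> >
  0. Subtracting the two equations cancels their mutual overlap, and any third user overlaps j by at
  most \<delta> more than i. This gives \<open>\<beta> * \<delta> \<le> \<alpha> * real (card ?K) *
  \<delta>\<close>, which the rate condition forbids.\<close>

lemma fifo:
  assumes bal: "balanced S \<alpha> \<beta> a d" and fin: "finite S" and "\<alpha> > 0"
    and rate: "\<alpha> * (real (card S) - 1) < \<beta>"
    and i: "i \<in> S" and j: "j \<in> S" and le: "d i \<le> d j"
  shows "a i \<le> a j"
proof (rule ccontr)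
  assume "\<not> a i \<le> a j"
  then have less: "a j < a i" and ij: "i \<noteq> j" by auto
  define \<delta> where "\<delta> = (d j - a j) - (d i - a i)"
  have "\<delta> > 0" using less le by (simp add: \<delta>_def)
  let ?K = "S - {i, j}"
  have eq: "\<beta> * (d k - a k) - \<alpha> * (\<Sum>l\<in>S - {k}. overlap a d k l) = 1" if "k \<in> S" for k
    using bal that by (simp add: balanced_def)
  have K: "S - {j} - {i} = ?K" "S - {i} - {j} = ?K" by auto
  have sj: "(\<Sum>l\<in>S - {j}. overlap a d j l) = overlap a d i j + (\<Sum>l\<in>?K. overlap a d j l)"
    using fin i ij sum.remove[of "S - {j}" i "overlap a d j"]
    by (simp add: K overlap_commute[of a d j i])
  have si: "(\<Sum>l\<in>S - {i}. overlap a d i l) = overlap a d i j + (\<Sum>l\<in>?K. overlap a d i l)"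
    using fin j ij sum.remove[of "S - {i}" j "overlap a d i"]
    by (simp add: K)
  have "overlap a d j l \<le> overlap a d i l + \<delta>" for l
    using less le by (auto simp: overlap_def \<delta>_def)
  then have "(\<Sum>l\<in>?K. overlap a d j l) \<le> (\<Sum>l\<in>?K. overlap a d i l + \<delta>)"
    by (intro sum_mono) auto
  also have "\<dots> = (\<Sum>l\<in>?K. overlap a d i l) + real (card ?K) * \<delta>"
    by (simp add: sum.distrib)
  finally have "\<alpha> * (\<Sum>l\<in>?K. overlap a d j l)
      \<le> \<alpha> * ((\<Sum>l\<in>?K. overlap a d i l) + real (card ?K) * \<delta>)"
    using \<open>\<alpha> > 0\<close> by (intro mult_left_mono) auto
  with eq[OF i] eq[OF j] sj si have "\<beta> * \<delta> \<le> \<alpha> * real (card ?K) * \<delta>"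
    by (simp add: \<delta>_def algebra_simps)
  with \<open>\<delta> > 0\<close> have "\<beta> \<le> \<alpha> * real (card ?K)"
    by simp
  moreover have "real (card ?K) \<le> real (card S) - 1"
  proof -
    have "card ?K \<le> card (S - {i})"
      using fin by (intro card_mono) auto
    also have "card (S - {i}) < card S"
      using fin i by (intro psubset_card_mono) auto
    finally show ?thesis by linarith
  qed
  then have "\<alpha> * real (card ?K) \<le> \<alpha> * (real (card S) - 1)"
    using \<open>\<alpha> > 0\<close> by (intro mult_left_mono) auto
  ultimately show False using rate by linarith
qed

text \<open>Take a user i with the latest departure among those whose arrivals differ. Overlaps with
  users departing strictly later agree in both solutions, and every other overlap changes by at most
  the difference of the two arrivals of i. As \<beta> exceeds \<alpha> times the number of other
  users, the equations of i force that difference to be 0.\<close>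

lemma arrivals_unique:
  assumes bal: "balanced S \<alpha> \<beta> a d" "balanced S \<alpha> \<beta> a' d" and fin: "finite S" and "\<alpha> > 0"
    and rate: "\<alpha> * (real (card S) - 1) < \<beta>"
  shows "\<forall>i\<in>S. a i = a' i"
proof (rule ccontr)
  assume neq: "\<not> (\<forall>i\<in>S. a i = a' i)"
  define D where "D = {i \<in> S. a i \<noteq> a' i}"
  have "finite D" "D \<noteq> {}" using fin neq by (auto simp: D_def)
  then have "Max (d ` D) \<in> d ` D" by simp
  then obtain i where i: "i \<in> D" "d i = Max (d ` D)" by auto
  have "d j \<le> d i" if "j \<in> D" for j
    using that i \<open>finite D\<close> by simp
  then have same: "a j = a' j" if "j \<in> S" "d i < d j" for j
    using that unfolding D_def by (metis (mono_tags, lifting) mem_Collect_eq not_le)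
  have iS: "i \<in> S" and ne: "a i \<noteq> a' i" using i by (auto simp: D_def)
  \<comment> \<open>By \<open>fifo\<close> the departures decide which interval starts later, so the
    overlap depends on one arrival only: that of the user departing later, and that of i in a
    tie.\<close>
  have ov: "overlap x d i j = (if d j \<le> d i then max 0 (d j - x i) else max 0 (d i - x j))"
    if "balanced S \<alpha> \<beta> x d" "j \<in> S" for x j
    using fifo[OF that(1) fin \<open>\<alpha> > 0\<close> rate iS that(2)] fifo[OF that(1) fin \<open>\<alpha> > 0\<close> rate that(2) iS]
    by (auto simp: overlap_def)
  have diff: "\<bar>overlap a d i j - overlap a' d i j\<bar> \<le> \<bar>a i - a' i\<bar>" if "j \<in> S" for j
    using that same[of j] by (auto simp: ov bal)
  have card: "real (card (S - {i})) = real (card S) - 1"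
    using card_Suc_Diff1[OF fin iS] by linarith
  from diff have "\<bar>(\<Sum>j\<in>S - {i}. overlap a d i j - overlap a' d i j)\<bar> \<le> (\<Sum>j\<in>S - {i}. \<bar>a i - a' i\<bar>)"
    by (intro order.trans[OF sum_abs] sum_mono) auto
  also have "\<dots> = (real (card S) - 1) * \<bar>a i - a' i\<bar>"
    by (simp only: sum_constant card)
  finally have le: "\<alpha> * \<bar>(\<Sum>j\<in>S - {i}. overlap a d i j - overlap a' d i j)\<bar>
      \<le> \<alpha> * ((real (card S) - 1) * \<bar>a i - a' i\<bar>)"
    using \<open>\<alpha> > 0\<close> by (intro mult_left_mono) auto
  have eq: "\<beta> * (d i - x i) - \<alpha> * (\<Sum>j\<in>S - {i}. overlap x d i j) = 1"
    if "balanced S \<alpha> \<beta> x d" for x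
    using that iS by (simp add: balanced_def)
  have "\<alpha> * (\<Sum>j\<in>S - {i}. overlap a d i j - overlap a' d i j) = \<beta> * (a' i - a i)"
    using eq[OF bal(1)] eq[OF bal(2)] by (simp add: sum_subtractf algebra_simps)
  then have "\<alpha> * \<bar>(\<Sum>j\<in>S - {i}. overlap a d i j - overlap a' d i j)\<bar> = \<bar>\<beta>\<bar> * \<bar>a i - a' i\<bar>"
    using \<open>\<alpha> > 0\<close> by (metis abs_minus_commute abs_mult abs_of_pos)
  with le have "\<bar>\<beta>\<bar> * \<bar>a i - a' i\<bar> \<le> (\<alpha> * (real (card S) - 1)) * \<bar>a i - a' i\<bar>"
    by (simp add: mult.assoc)
  with ne rate show False by simp
qed

text \<open>Running time backwards swaps arrivals with departures and keeps overlap lengths. Facts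
  about arrivals for given departures thereby become facts about departures for given
  arrivals.\<close>

lemma balanced_reverse:
  "balanced S \<alpha> \<beta> (\<lambda>i. - d i) (\<lambda>i. - a i) \<longleftrightarrow> balanced S \<alpha> \<beta> a d"
proof -
  have "overlap (\<lambda>i. - d i) (\<lambda>i. - a i) i j = overlap a d i j" for i j
    by (simp add: overlap_def min_def max_def)
  then show ?thesis by (simp add: balanced_def)
qed

lemma departures_unique:
  assumes "balanced S \<alpha> \<beta> a d" "balanced S \<alpha> \<beta> a d'" "finite S" "\<alpha> > 0"
    and "\<alpha> * (real (card S) - 1) < \<beta>"
  shows "\<forall>i\<in>S. d i = d' i"
  using arrivals_unique[of S \<alpha> \<beta> "\<lambda>i. - d i" "\<lambda>i. - a i" "\<lambda>i. - d' i"] assms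
  by (simp add: balanced_reverse)

section \<open>Relabelling users into sorted order\<close>

lemma balanced_reindex:
  assumes "inj_on \<pi> S"
  shows "balanced S \<alpha> \<beta> (a \<circ> \<pi>) (d \<circ> \<pi>) \<longleftrightarrow> balanced (\<pi> ` S) \<alpha> \<beta> a d"
proof -
  have "(\<Sum>j\<in>\<pi> ` S - {\<pi> i}. overlap a d (\<pi> i) j)
      = (\<Sum>j\<in>S - {i}. overlap (a \<circ> \<pi>) (d \<circ> \<pi>) i j)" if "i \<in> S" for i
  proof -
    have "\<pi> ` S - {\<pi> i} = \<pi> ` (S - {i})"
      using assms that by (auto simp: inj_on_def)
    moreover have "inj_on \<pi> (S - {i})"
      using assms by (rule inj_on_subset) auto
    ultimately show ?thesis
      by (simp add: sum.reindex overlap_def o_def)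
  qed
  then show ?thesis by (simp add: balanced_def)
qed

lemma ex_sorting_permutation:
  fixes f :: "nat \<Rightarrow> 'b :: linorder"
  obtains \<pi> where "bij_betw \<pi> {1..N} {1..N}" "mono_on {1..N} (f \<circ> \<pi>)"
proof -
  define xs where "xs = sort_key f [1..<Suc N]"
  have len: "length xs = N" and set: "set xs = {1..N}" and dist: "distinct xs"
    and sorted: "sorted (map f xs)"
    by (auto simp: xs_def)
  have "bij_betw ((!) xs) {..<N} {1..N}"
    using bij_betw_nth[OF dist, of "{..<N}" "{1..N}"] len set by simp
  \<comment> \<open>List positions start at 0, users at 1.\<close>
  moreover have "bij_betw (\<lambda>i. i - 1) {1..N} {..<N}"
    by (rule bij_betw_byWitness[where f' = Suc]) auto
  ultimately have "bij_betw ((!) xs \<circ> (\<lambda>i. i - 1)) {1..N} {1..N}"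
    by (rule bij_betw_trans[rotated])
  moreover have "mono_on {1..N} (f \<circ> ((!) xs \<circ> (\<lambda>i. i - 1)))"
  proof (rule mono_onI)
    fix r s assume "r \<in> {1..N}" "s \<in> {1..N}" "r \<le> s"
    then show "(f \<circ> ((!) xs \<circ> (\<lambda>i. i - 1))) r \<le> (f \<circ> ((!) xs \<circ> (\<lambda>i. i - 1))) s"
      using sorted_nth_mono[OF sorted, of "r - 1" "s - 1"] len by auto
  qed
  ultimately show ?thesis by (rule that)
qed

section \<open>The schedule for sorted departures\<close>

text \<open>For a nonzero denominator this is the root x of
  \<open>\<beta> * x + \<alpha> * (\<Sum>j=k..<i. d j - x) = c\<close>: the arrival of i if, among
  the users before i, exactly k, ..., i - 1 were still present.\<close>

definition line_root :: "real \<Rightarrow> real \<Rightarrow> (nat \<Rightarrow> real) \<Rightarrow> nat \<Rightarrow> real \<Rightarrow> nat \<Rightarrow> real" where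
  "line_root \<alpha> \<beta> d i c k = (c - \<alpha> * (\<Sum>j=k..<i. d j)) / (\<beta> - \<alpha> * (real i - real k))"

text \<open>For sorted \<open>d\<close> the sum of positive parts is the largest of the tail sums
  \<open>\<Sum>j=k..<i. d j - x\<close>, so the left-hand side is a maximum of lines with positive
  slopes. At the smallest root every line is at most c and one line equals c.\<close>

lemma Min_line_root:
  fixes c :: real
  assumes mono: "mono_on {1..<i} d" and "\<alpha> > 0" and "i \<ge> 1" and rate: "\<alpha> * (real i - 1) < \<beta>"
  defines "x \<equiv> Min (line_root \<alpha> \<beta> d i c ` {1..i})"
  shows "\<beta> * x + \<alpha> * (\<Sum>j=1..<i. max 0 (d j - x)) = c"
proof -
  let ?l = "\<lambda>k. \<beta> * x + \<alpha> * (\<Sum>j=k..<i. d j - x)"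
  have l: "?l k = (\<beta> - \<alpha> * (real i - real k)) * x + \<alpha> * (\<Sum>j=k..<i. d j)" if "k \<in> {1..i}" for k
    using that by (simp add: sum_subtractf of_nat_diff algebra_simps)
  have pos: "\<beta> - \<alpha> * (real i - real k) > 0" if "k \<in> {1..i}" for k
  proof -
    have "\<alpha> * (real i - real k) \<le> \<alpha> * (real i - 1)"
      using \<open>\<alpha> > 0\<close> that by (intro mult_left_mono) auto
    with rate show ?thesis by simp
  qed
  have le: "?l k \<le> c" if k: "k \<in> {1..i}" for k
  proof -
    have "x \<le> line_root \<alpha> \<beta> d i c k"
      unfolding x_def using k by (intro Min_le) auto
    then show ?thesis
      using pos[OF k] unfolding l[OF k] line_root_def by (simp add: pos_le_divide_eq mult.commute)
  qed
  have "x \<in> line_root \<alpha> \<beta> d i c ` {1..i}"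
    unfolding x_def using \<open>i \<ge> 1\<close> by (intro Min_in) auto
  then obtain k where k: "k \<in> {1..i}" "x = line_root \<alpha> \<beta> d i c k" by auto
  have "(\<beta> - \<alpha> * (real i - real k)) * x = c - \<alpha> * (\<Sum>j=k..<i. d j)"
    using pos[OF k(1)] k(2) by (simp add: line_root_def)
  then have "c = ?l k"
    using l[OF k(1)] by linarith
  have "(\<Sum>j=k..<i. d j - x) \<le> (\<Sum>j=k..<i. max 0 (d j - x))"
    by (intro sum_mono) auto
  also have "\<dots> \<le> (\<Sum>j=1..<i. max 0 (d j - x))"
    using k by (intro sum_mono2) auto
  finally have "\<alpha> * (\<Sum>j=k..<i. d j - x) \<le> \<alpha> * (\<Sum>j=1..<i. max 0 (d j - x))"
    using \<open>\<alpha> > 0\<close> by (intro mult_left_mono) auto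
  with \<open>c = ?l k\<close> have "c \<le> \<beta> * x + \<alpha> * (\<Sum>j=1..<i. max 0 (d j - x))"
    by linarith
  moreover have "\<beta> * x + \<alpha> * (\<Sum>j=1..<i. max 0 (d j - x)) \<le> c"
  proof -
    \<comment> \<open>The tail attaining the maximum starts at the first user m departing after x; m
      = i stands for the empty tail.\<close>
    have "\<exists>m. m \<ge> 1 \<and> (m = i \<or> x < d m)"
      using \<open>i \<ge> 1\<close> by blast
    then obtain m where m: "m \<ge> 1" "m = i \<or> x < d m"
      and least: "\<forall>j<m. \<not> (j \<ge> 1 \<and> (j = i \<or> x < d j))"
      by (subst (asm) exists_least_iff) blast
    have "m \<le> i"
      using least[rule_format, of i] \<open>i \<ge> 1\<close> by (cases "i < m") auto
    have below: "d j \<le> x" if "1 \<le> j" "j < m" for j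
      using least[rule_format, of j] that by simp
    have above: "x < d j" if "m \<le> j" "j < i" for j
      using m that mono_onD[OF mono, of m j] by auto
    have "(\<Sum>j=1..<i. max 0 (d j - x))
        = (\<Sum>j=1..<m. max 0 (d j - x)) + (\<Sum>j=m..<i. max 0 (d j - x))"
      using m(1) \<open>m \<le> i\<close> by (rule sum.atLeastLessThan_concat[symmetric])
    also have "(\<Sum>j=1..<m. max 0 (d j - x)) = 0"
      using below by (intro sum.neutral) auto
    also have "(\<Sum>j=m..<i. max 0 (d j - x)) = (\<Sum>j=m..<i. d j - x)"
      using above by (intro sum.cong refl) (simp add: less_imp_le)
    finally show ?thesis
      using le[of m] m(1) \<open>m \<le> i\<close> by simp
  qed
  ultimately show ?thesis by (rule antisym[rotated])
qed

text \<open>Backward substitution: the constant passed to \<open>line_root\<close> collects the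
  overlaps with later users, whose arrivals are already determined.\<close>

function schedule :: "nat \<Rightarrow> real \<Rightarrow> real \<Rightarrow> (nat \<Rightarrow> real) \<Rightarrow> nat \<Rightarrow> real" where
  "schedule N \<alpha> \<beta> d i =
     Min (line_root \<alpha> \<beta> d i
       (\<beta> * d i - 1 - \<alpha> * (\<Sum>j\<in>{i<..N}. max 0 (d i - schedule N \<alpha> \<beta> d j))) ` {1..i})"
  by auto
termination
  by (relation "Wellfounded.measure (\<lambda>(N, \<alpha>, \<beta>, d, i). N - i)") auto

declare schedule.simps [simp del]

text \<open>Not yet the departure equation: the positive parts are identified with overlaps only
  after the arrivals are known to be sorted, which \<open>schedule_mono\<close> supplies.\<close>

lemma schedule_eq:
  assumes mono: "mono_on {1..N} d" and "\<alpha> > 0" and rate: "\<alpha> * (real N - 1) < \<beta>"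
    and i: "i \<in> {1..N}"
  shows "\<beta> * schedule N \<alpha> \<beta> d i + \<alpha> * (\<Sum>j=1..<i. max 0 (d j - schedule N \<alpha> \<beta> d i))
    = \<beta> * d i - 1 - \<alpha> * (\<Sum>j\<in>{i<..N}. max 0 (d i - schedule N \<alpha> \<beta> d j))"
proof -
  define c where
    "c = \<beta> * d i - 1 - \<alpha> * (\<Sum>j\<in>{i<..N}. max 0 (d i - schedule N \<alpha> \<beta> d j))"
  have eq: "schedule N \<alpha> \<beta> d i = Min (line_root \<alpha> \<beta> d i c ` {1..i})"
    unfolding c_def by (rule schedule.simps)
  have sub: "mono_on {1..<i} d"
    using mono by (rule mono_on_subset) (use i in auto)
  have "i \<ge> 1" using i by simp
  have "\<alpha> * (real i - 1) \<le> \<alpha> * (real N - 1)"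
    using i \<open>\<alpha> > 0\<close> by (intro mult_left_mono) auto
  then have "\<alpha> * (real i - 1) < \<beta>" using rate by linarith
  from Min_line_root[OF sub \<open>\<alpha> > 0\<close> \<open>i \<ge> 1\<close> this, of c] show ?thesis
    unfolding eq c_def .
qed

section \<open>Order of the computed arrivals\<close>

lemma sum_max_diff_le:
  fixes u v \<alpha> \<beta> :: real
  assumes "u \<le> v" "finite A" "\<alpha> > 0" "\<alpha> * real (card A) \<le> \<beta>"
  shows "\<beta> * u - \<alpha> * (\<Sum>j\<in>A. max 0 (u - f j)) \<le> \<beta> * v - \<alpha> * (\<Sum>j\<in>A. max 0 (v - f j))"
proof -
  \<comment> \<open>Raising u to v enlarges each positive part by at most \<open>v - u\<close>, so
    the slope is at least \<open>\<beta> - \<alpha> * real (card A)\<close>.\<close>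
  have "(\<Sum>j\<in>A. max 0 (v - f j)) \<le> (\<Sum>j\<in>A. max 0 (u - f j) + (v - u))"
    using assms by (intro sum_mono) auto
  also have "\<dots> = (\<Sum>j\<in>A. max 0 (u - f j)) + real (card A) * (v - u)"
    by (simp add: sum.distrib)
  finally have "\<alpha> * (\<Sum>j\<in>A. max 0 (v - f j))
      \<le> \<alpha> * ((\<Sum>j\<in>A. max 0 (u - f j)) + real (card A) * (v - u))"
    using assms by (intro mult_left_mono) auto
  moreover have "\<alpha> * real (card A) * (v - u) \<le> \<beta> * (v - u)"
    using assms by (intro mult_right_mono) auto
  ultimately show ?thesis by (simp add: algebra_simps)
qed

lemma sum_max_less:
  fixes u v \<alpha> \<beta> :: real
  assumes "u < v" "finite A" "\<alpha> > 0" "\<alpha> * real (card A) < \<beta>"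
  shows "\<beta> * u + \<alpha> * (\<Sum>j\<in>A. max 0 (f j - u)) < \<beta> * v + \<alpha> * (\<Sum>j\<in>A. max 0 (f j - v))"
proof -
  have "(\<Sum>j\<in>A. max 0 (f j - u)) \<le> (\<Sum>j\<in>A. max 0 (f j - v) + (v - u))"
    using assms by (intro sum_mono) auto
  also have "\<dots> = (\<Sum>j\<in>A. max 0 (f j - v)) + real (card A) * (v - u)"
    by (simp add: sum.distrib)
  finally have "\<alpha> * (\<Sum>j\<in>A. max 0 (f j - u))
      \<le> \<alpha> * ((\<Sum>j\<in>A. max 0 (f j - v)) + real (card A) * (v - u))"
    using assms by (intro mult_left_mono) auto
  moreover have "\<alpha> * real (card A) * (v - u) < \<beta> * (v - u)"
    using assms by (intro mult_strict_right_mono) auto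
  ultimately show ?thesis by (simp add: algebra_simps)
qed

context
  fixes N :: nat and \<alpha> \<beta> :: real and d :: "nat \<Rightarrow> real"
  assumes mono: "mono_on {1..N} d" and pos: "\<alpha> > 0" and rate: "\<alpha> * (real N - 1) < \<beta>"
begin

private abbreviation (input) a where "a \<equiv> schedule N \<alpha> \<beta> d"

lemma card_rate:
  assumes "card A < N"
  shows "\<alpha> * real (card A) < \<beta>"
proof -
  have "\<alpha> * real (card A) \<le> \<alpha> * (real N - 1)"
    using assms pos by (intro mult_left_mono) auto
  with rate show ?thesis by simp
qed

text \<open>Comparison principle: by \<open>sum_max_less\<close> the left-hand side of
  \<open>schedule_eq\<close> is strictly increasing in the arrival time, so a y at which it reaches
  the constant bounds the solution from above.\<close>

lemma schedule_leI:
  assumes i: "i \<in> {1..N}"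
    and le: "\<beta> * d i - 1 - \<alpha> * (\<Sum>j\<in>{i<..N}. max 0 (d i - a j))
      \<le> \<beta> * y + \<alpha> * (\<Sum>j=1..<i. max 0 (d j - y))"
  shows "a i \<le> y"
proof (rule ccontr)
  assume "\<not> a i \<le> y"
  then have "\<beta> * y + \<alpha> * (\<Sum>j=1..<i. max 0 (d j - y))
      < \<beta> * a i + \<alpha> * (\<Sum>j=1..<i. max 0 (d j - a i))"
    using i pos by (intro sum_max_less card_rate) auto
  with le schedule_eq[OF mono pos rate i] show False by simp
qed

lemma schedule_le_departure:
  assumes i: "i \<in> {1..N}"
  shows "a i \<le> d i"
proof (rule schedule_leI[OF i])
  \<comment> \<open>At y = d i the earlier departures leave no positive part, and the constant lies
    below \<open>\<beta> * d i\<close>.\<close>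
  have "(\<Sum>j=1..<i. max 0 (d j - d i)) = 0"
    using i mono_onD[OF mono, of _ i] by (intro sum.neutral) auto
  moreover have "0 \<le> \<alpha> * (\<Sum>j\<in>{i<..N}. max 0 (d i - a j))"
    using pos by (intro mult_nonneg_nonneg sum_nonneg) auto
  ultimately show "\<beta> * d i - 1 - \<alpha> * (\<Sum>j\<in>{i<..N}. max 0 (d i - a j))
      \<le> \<beta> * d i + \<alpha> * (\<Sum>j=1..<i. max 0 (d j - d i))" by simp
qed

text \<open>Compare at y = \<open>a (Suc i)\<close>. The term of user \<open>Suc i\<close> in the
  constant of i and the term of i in the equation of \<open>Suc i\<close> are both
  \<open>max 0 (d i - ?y)\<close> and cancel; the rest is \<open>sum_max_diff_le\<close> for
  \<open>d i \<le> d (Suc i)\<close>.\<close>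

lemma schedule_le_Suc:
  assumes i: "1 \<le> i" "i < N"
  shows "a i \<le> a (Suc i)"
proof (rule schedule_leI)
  let ?y = "a (Suc i)"
  have "{i<..N} = insert (Suc i) {Suc i<..N}"
    using i by auto
  then have split: "(\<Sum>j\<in>{i<..N}. max 0 (d i - a j))
      = max 0 (d i - ?y) + (\<Sum>j\<in>{Suc i<..N}. max 0 (d i - a j))"
    by simp
  have "d i \<le> d (Suc i)"
    using i mono_onD[OF mono, of i "Suc i"] by auto
  then have "\<beta> * d i - \<alpha> * (\<Sum>j\<in>{Suc i<..N}. max 0 (d i - a j))
      \<le> \<beta> * d (Suc i) - \<alpha> * (\<Sum>j\<in>{Suc i<..N}. max 0 (d (Suc i) - a j))"
    using i pos by (intro sum_max_diff_le less_imp_le[OF card_rate]) auto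
  also have "\<dots> = 1 + \<beta> * ?y + \<alpha> * (\<Sum>j=1..<Suc i. max 0 (d j - ?y))"
    using schedule_eq[OF mono pos rate, of "Suc i"] i by simp
  finally show "\<beta> * d i - 1 - \<alpha> * (\<Sum>j\<in>{i<..N}. max 0 (d i - a j))
      \<le> \<beta> * ?y + \<alpha> * (\<Sum>j=1..<i. max 0 (d j - ?y))"
    using i split by (simp add: algebra_simps)
qed (use i in auto)

lemma schedule_mono:
  assumes "1 \<le> i" "i \<le> j" "j \<le> N"
  shows "a i \<le> a j"
  using assms(2,3)
proof (induction j rule: dec_induct)
  case (step n)
  then show ?case using schedule_le_Suc[of n] assms(1) by simp
qed simp

lemma balanced_schedule: "balanced {1..N} \<alpha> \<beta> a d"
  unfolding balanced_def
proof (intro ballI conjI)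
  fix i assume i: "i \<in> {1..N}"
  show "a i \<le> d i" by (rule schedule_le_departure[OF i])
  have sets: "{1..N} - {i} = {1..<i} \<union> {i<..N}"
    using i by auto
  have "(\<Sum>j\<in>{1..N} - {i}. overlap a d i j)
      = (\<Sum>j=1..<i. overlap a d i j) + (\<Sum>j\<in>{i<..N}. overlap a d i j)"
    unfolding sets by (rule sum.union_disjoint) auto
  also have "(\<Sum>j=1..<i. overlap a d i j) = (\<Sum>j=1..<i. max 0 (d j - a i))"
  proof (rule sum.cong)
    fix j assume "j \<in> {1..<i}"
    then have "d j \<le> d i" "a j \<le> a i"
      using i mono_onD[OF mono, of j i] schedule_mono[of j i] by auto
    then show "overlap a d i j = max 0 (d j - a i)" by (simp add: overlap_def)
  qed simp
  also have "(\<Sum>j\<in>{i<..N}. overlap a d i j) = (\<Sum>j\<in>{i<..N}. max 0 (d i - a j))"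
  proof (rule sum.cong)
    fix j assume "j \<in> {i<..N}"
    then have "d i \<le> d j" "a i \<le> a j"
      using i mono_onD[OF mono, of i j] schedule_mono[of i j] by auto
    then show "overlap a d i j = max 0 (d i - a j)" by (simp add: overlap_def)
  qed simp
  finally show "\<beta> * (d i - a i) - \<alpha> * (\<Sum>j\<in>{1..N} - {i}. overlap a d i j) = 1"
    using schedule_eq[OF mono pos rate i] by (simp add: algebra_simps)
qed

end

section \<open>Existence of departures, zero cost and optimality\<close>

lemma ex_balanced_departures:
  assumes "\<alpha> > 0" and "\<alpha> * (real N - 1) < \<beta>"
  shows "\<exists>d. balanced {1..N} \<alpha> \<beta> a d"
proof -
  \<comment> \<open>The values \<open>- a i\<close> are the departures of the time-reversed problem,
    sorted here because \<open>balanced_schedule\<close> requires monotone departures.\<close>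
  obtain \<pi> where \<pi>: "bij_betw \<pi> {1..N} {1..N}" and mono: "mono_on {1..N} ((\<lambda>i. - a i) \<circ> \<pi>)"
    by (rule ex_sorting_permutation[of N "\<lambda>i. - a i"])
  \<comment> \<open>Undoing the permutation returns the computed times to the original users; the
    departures sought are their negatives.\<close>
  define b where "b = schedule N \<alpha> \<beta> ((\<lambda>i. - a i) \<circ> \<pi>) \<circ> the_inv_into {1..N} \<pi>"
  have "balanced {1..N} \<alpha> \<beta> (schedule N \<alpha> \<beta> ((\<lambda>i. - a i) \<circ> \<pi>)) ((\<lambda>i. - a i) \<circ> \<pi>)"
    by (rule balanced_schedule[OF mono assms])
  also have "?this \<longleftrightarrow> balanced {1..N} \<alpha> \<beta> (b \<circ> \<pi>) ((\<lambda>i. - a i) \<circ> \<pi>)"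
    using \<pi> unfolding balanced_def
    by (intro ball_cong refl) (simp add: b_def overlap_def the_inv_into_f_f bij_betw_imp_inj_on)
  also have "\<dots> \<longleftrightarrow> balanced {1..N} \<alpha> \<beta> b (\<lambda>i. - a i)"
    using \<pi> by (simp add: balanced_reindex bij_betw_def)
  finally show ?thesis
    using balanced_reverse[of "{1..N}" \<alpha> \<beta> "\<lambda>i. - b i" a] by auto
qed

lemma balanced_restrict:
  "balanced S \<alpha> \<beta> (restrict a S) d \<longleftrightarrow> balanced S \<alpha> \<beta> a d"
  "balanced S \<alpha> \<beta> a (restrict d S) \<longleftrightarrow> balanced S \<alpha> \<beta> a d"
  unfolding balanced_def by (auto simp: overlap_def)

lemma rvec_eqI:
  assumes "x \<in> rvec N" "y \<in> rvec N" "\<forall>i\<in>{1..N}. x i = y i"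
  shows "x = y"
  using assms unfolding rvec_def by (metis PiE_ext)

lemma restrict_in_rvec: "restrict x {1..N} \<in> rvec N"
  by (simp add: rvec_def)

text \<open>Existence and uniqueness of departures justify replacing the definite description by its
  defining property.\<close>

lemma departure_eq_iff:
  assumes "\<alpha> > 0" and "\<alpha> * (real N - 1) < \<beta>"
  shows "departure N \<alpha> \<beta> a = d \<longleftrightarrow> is_departure N \<alpha> \<beta> a d"
proof -
  obtain e where "balanced {1..N} \<alpha> \<beta> a e"
    using ex_balanced_departures[OF assms] by blast
  then have "is_departure N \<alpha> \<beta> a (restrict e {1..N})"
    using restrict_in_rvec[of e N] by (simp add: is_departure_iff_balanced balanced_restrict)
  moreover have "x = y" if "is_departure N \<alpha> \<beta> a x" "is_departure N \<alpha> \<beta> a y" for x y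
    using that departures_unique[of "{1..N}" \<alpha> \<beta> a x y] assms rvec_eqI[of x N y]
    by (simp add: is_departure_iff_balanced)
  ultimately have "\<exists>!d. is_departure N \<alpha> \<beta> a d" by blast
  then show ?thesis
    unfolding departure_def by (metis (mono_tags, lifting) theI_unique)
qed

lemma total_cost_0_iff:
  assumes "\<alpha> > 0" and "\<alpha> * (real N - 1) < \<beta>" and "dstar \<in> rvec N"
  shows "total_cost N \<alpha> \<beta> 0 dstar a = 0 \<longleftrightarrow> balanced {1..N} \<alpha> \<beta> a dstar"
proof -
  have "total_cost N \<alpha> \<beta> 0 dstar a = 0 \<longleftrightarrow> (\<forall>i\<in>{1..N}. departure N \<alpha> \<beta> a i = dstar i)"
    by (simp add: total_cost_def sum_nonneg_eq_0_iff)
  also have "\<dots> \<longleftrightarrow> departure N \<alpha> \<beta> a = dstar"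
    using departure_eq_iff[OF assms(1,2), of a "departure N \<alpha> \<beta> a"] assms(3)
      rvec_eqI[of "departure N \<alpha> \<beta> a" N dstar]
    by (auto simp: is_departure_def)
  also have "\<dots> \<longleftrightarrow> balanced {1..N} \<alpha> \<beta> a dstar"
    using assms by (simp add: departure_eq_iff is_departure_iff_balanced)
  finally show ?thesis .
qed

lemma optimal_schedule_iff:
  assumes "\<alpha> > 0" and "\<alpha> * (real N - 1) < \<beta>" and "dstar \<in> rvec N" and "mono_on {1..N} dstar"
  shows "optimal_schedule N \<alpha> \<beta> 0 dstar a \<longleftrightarrow> a = restrict (schedule N \<alpha> \<beta> dstar) {1..N}"
    and "total_cost N \<alpha> \<beta> 0 dstar (restrict (schedule N \<alpha> \<beta> dstar) {1..N}) = 0"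
proof -
  let ?a = "restrict (schedule N \<alpha> \<beta> dstar) {1..N}"
  have bal: "balanced {1..N} \<alpha> \<beta> ?a dstar"
    using balanced_schedule assms by (simp add: balanced_restrict)
  then show zero: "total_cost N \<alpha> \<beta> 0 dstar ?a = 0"
    using assms by (simp add: total_cost_0_iff)
  have nonneg: "total_cost N \<alpha> \<beta> 0 dstar b \<ge> 0" for b
    by (simp add: total_cost_def sum_nonneg)
  \<comment> \<open>The cost is nonnegative and attains 0, so its minimizers are exactly its
    zeros.\<close>
  have "optimal_schedule N \<alpha> \<beta> 0 dstar a \<longleftrightarrow> a \<in> rvec N \<and> total_cost N \<alpha> \<beta> 0 dstar a = 0"
    unfolding optimal_schedule_def is_arg_min_def
    using zero nonneg restrict_in_rvec[of "schedule N \<alpha> \<beta> dstar" N]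
    by (metis less_eq_real_def not_le)
  also have "\<dots> \<longleftrightarrow> a \<in> rvec N \<and> balanced {1..N} \<alpha> \<beta> a dstar"
    using assms by (simp add: total_cost_0_iff)
  also have "\<dots> \<longleftrightarrow> a = ?a"
    using arrivals_unique[of "{1..N}" \<alpha> \<beta> a dstar ?a] bal assms rvec_eqI[of a N ?a]
      restrict_in_rvec[of "schedule N \<alpha> \<beta> dstar" N] by auto
  finally show "optimal_schedule N \<alpha> \<beta> 0 dstar a \<longleftrightarrow> a = ?a" .
qed


section \<open>The program\<close>

text \<open>Weakest precondition with a clock: t is the time already spent, and the postcondition
  sees the total. The existential includes termination and the absence of division by zero; as
  execution is deterministic, asking for some execution loses nothing.\<close>

definition wp :: "prog \<Rightarrow> (nat \<Rightarrow> state \<Rightarrow> bool) \<Rightarrow> nat \<Rightarrow> state \<Rightarrow> bool" where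
  "wp c Q t s \<longleftrightarrow> (\<exists>T s'. exec c s T s' \<and> Q (t + T) s')"

lemma wp_simps [simp]:
  "wp Skip Q t s = Q t s"
  "wp (ISet x n) Q t s = Q (Suc t) (set_idx x n s)"
  "wp (ICopy x y) Q t s = Q (Suc t) (set_idx x (idx s y) s)"
  "wp (ISuc x) Q t s = Q (Suc t) (set_idx x (Suc (idx s x)) s)"
  "wp (IPred x) Q t s = Q (Suc t) (set_idx x (idx s x - 1) s)"
  "wp (RZero p) Q t s = Q (Suc t) (wr p 0 s)"
  "wp (ROne p) Q t s = Q (Suc t) (wr p 1 s)"
  "wp (RCopy p q) Q t s = Q (Suc t) (wr p (rd s q) s)"
  by (auto simp: wp_def simp flip: Suc_eq_plus1
      elim!: exec_SkipE exec_ISetE exec_ICopyE exec_ISucE exec_IPredE exec_RZeroE exec_ROneE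
        exec_RCopyE intro!: exI exec.intros[simplified] intro: exec.intros)

lemma wp_RArith [simp]:
  "wp (RArith p f q r) Q t s \<longleftrightarrow>
    (f = Divide \<longrightarrow> rd s r \<noteq> 0) \<and> Q (Suc t) (wr p (apply_op f (rd s q) (rd s r)) s)"
  by (auto simp: wp_def elim!: exec_RArithE intro!: exI exec.RArith[simplified])

lemma wp_Seq [simp]: "wp (Seq c1 c2) Q t s = wp c1 (wp c2 Q) t s"
proof -
  have "exec (Seq c1 c2) s T s' \<longleftrightarrow>
      (\<exists>T1 s1 T2. T = T1 + T2 \<and> exec c1 s T1 s1 \<and> exec c2 s1 T2 s')" for T s'
    by (auto elim!: exec_SeqE intro: exec.Seq)
  then have "wp (Seq c1 c2) Q t s \<longleftrightarrow>
      (\<exists>T1 s1 T2 s'. exec c1 s T1 s1 \<and> exec c2 s1 T2 s' \<and> Q (t + (T1 + T2)) s')"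
    unfolding wp_def by (simp only:) blast
  then show ?thesis
    unfolding wp_def by (simp add: add.assoc)
qed

lemma wp_Cond [simp]:
  "wp (Cond b c1 c2) Q t s = (if holds b s then wp c1 Q (Suc t) s else wp c2 Q (Suc t) s)"
proof -
  have "exec (Cond b c1 c2) s T s' \<longleftrightarrow>
      (\<exists>U. T = Suc U \<and> exec (if holds b s then c1 else c2) s U s')" for T s'
    by (auto elim!: exec_CondE intro: exec.CondT[simplified] exec.CondF[simplified])
  then show ?thesis
    by (cases "holds b s") (simp_all add: wp_def, (metis add_Suc_right)+)
qed

text \<open>The index n of the invariant doubles as termination measure, dropping by one per round.
  \<open>Suc t\<close> charges the test of the guard.\<close>

lemma wp_Loop:
  fixes I :: "nat \<Rightarrow> nat \<Rightarrow> state \<Rightarrow> bool"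
  assumes "I n t s"
    and "\<And>n t s. I n t s \<Longrightarrow> holds b s \<Longrightarrow> n > 0 \<and> wp c (I (n - 1)) (Suc t) s"
    and "\<And>n t s. I n t s \<Longrightarrow> \<not> holds b s \<Longrightarrow> Q (Suc t) s"
  shows "wp (Loop b c) Q t s"
  using assms(1)
proof (induction n arbitrary: t s rule: less_induct)
  case (less n)
  show ?case
  proof (cases "holds b s")
    case True
    with assms(2) less.prems obtain T1 s1 where
      n: "n > 0" and 1: "exec c s T1 s1" "I (n - 1) (Suc t + T1) s1"
      unfolding wp_def by blast
    with less.IH[of "n - 1"] obtain T2 s2 where
      "exec (Loop b c) s1 T2 s2" "Q (Suc t + T1 + T2) s2"
      unfolding wp_def by fastforce
    with exec.LoopT[OF True 1(1)] show ?thesis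
      unfolding wp_def by (metis add.assoc plus_1_eq_Suc Suc_eq_plus1)
  next
    case False
    with assms(3)[OF less.prems] show ?thesis
      unfolding wp_def by (metis Suc_eq_plus1 exec.LoopF)
  qed
qed

text \<open>Index variables: 0 is \<open>N\<close>, 1 and 2 hold the constants 0 and 1, 3 is the current user \<open>i\<close>,
  4 is the inner counter. Cell 0 of the arrays 3 to 7 holds the constant 1, the numerator and
  the denominator of \<open>line_root\<close>, the smallest root so far, and a temporary value.\<close>

definition rhs_body :: prog where
  "rhs_body =
    Seq (ISuc 4)
      (Cond (RLess (2, 4) (1, 3))
        (Seq (RArith (7, 1) Minus (1, 3) (2, 4))
        (Seq (RArith (7, 1) Times (0, 1) (7, 1))
             (RArith (4, 1) Minus (4, 1) (7, 1))))
        Skip)"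

text \<open>Passing from k + 1 to k lowers the numerator by \<open>\<alpha> * d k\<close> and the
  denominator by \<alpha>, so each further root takes constant time and the whole program stays
  quadratic.\<close>

definition min_body :: prog where
  "min_body =
    Seq (RArith (7, 1) Times (0, 1) (1, 4))
    (Seq (RArith (4, 1) Minus (4, 1) (7, 1))
    (Seq (RArith (5, 1) Minus (5, 1) (0, 1))
    (Seq (RArith (7, 1) Divide (4, 1) (5, 1))
    (Seq (Cond (RLess (7, 1) (6, 1)) (RCopy (6, 1) (7, 1)) Skip)
         (IPred 4)))))"

definition user_body :: prog where
  "user_body =
    Seq (RArith (4, 1) Times (0, 2) (1, 3))
    (Seq (RArith (4, 1) Minus (4, 1) (3, 1))
    (Seq (ICopy 4 3)
    (Seq (Loop (ILess 4 0) rhs_body)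
    (Seq (RCopy (5, 1) (0, 2))
    (Seq (RArith (6, 1) Divide (4, 1) (5, 1))
    (Seq (ICopy 4 3)
    (Seq (IPred 4)
    (Seq (Loop (ILess 1 4) min_body)
    (Seq (RCopy (2, 3) (6, 1))
         (IPred 3))))))))))"

definition schedule_prog :: prog where
  "schedule_prog =
    Seq (ISet 2 1) (Seq (ROne (3, 1)) (Seq (ICopy 3 0) (Loop (ILess 1 3) user_body)))"

text \<open>What survives all inner computations: constants, input, and the arrivals of users after
  i. Index variable 4 and the scratch arrays 4 to 7 are left free.\<close>

definition env :: "nat \<Rightarrow> real \<Rightarrow> real \<Rightarrow> (nat \<Rightarrow> real) \<Rightarrow> nat \<Rightarrow> state \<Rightarrow> bool" where
  "env N \<alpha> \<beta> d i s \<longleftrightarrow>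
     idx s 0 = N \<and> idx s 1 = 0 \<and> idx s 2 = 1 \<and> idx s 3 = i \<and>
     arr s 0 0 = \<alpha> \<and> arr s 0 1 = \<beta> \<and> arr s 3 0 = 1 \<and>
     (\<forall>j\<in>{1..N}. arr s 1 j = d j) \<and> (\<forall>j\<in>{i<..N}. arr s 2 j = schedule N \<alpha> \<beta> d j)"

section \<open>Correctness and running time of the loops\<close>

lemma wp_rhs_loop:
  assumes "env N \<alpha> \<beta> d i s" "i \<in> {1..N}" "idx s 4 = i" "arr s 4 0 = c"
    and Q: "\<And>t' s'. \<lbrakk>env N \<alpha> \<beta> d i s'; t' \<le> t + 6 * N + 1;
      arr s' 4 0 = c - \<alpha> * (\<Sum>j\<in>{i<..N}. max 0 (d i - schedule N \<alpha> \<beta> d j))\<rbrakk> \<Longrightarrow> Q t' s'"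
  shows "wp (Loop (ILess 4 0) rhs_body) Q t s"
proof -
  \<comment> \<open>A round costs at most 6: the loop test, the increment, the comparison and three
    arithmetic operations. The comparison realizes the positive part.\<close>
  let ?I = "\<lambda>n t' s. env N \<alpha> \<beta> d i s \<and> i \<le> idx s 4 \<and> idx s 4 \<le> N \<and> n = N - idx s 4 \<and>
    arr s 4 0 = c - \<alpha> * (\<Sum>j\<in>{i<..idx s 4}. max 0 (d i - schedule N \<alpha> \<beta> d j)) \<and>
    t' \<le> t + 6 * (idx s 4 - i)"
  show ?thesis
  proof (rule wp_Loop[where I = ?I and n = "N - i"])
    fix n t' s assume I: "?I n t' s" and less: "holds (ILess 4 0) s"
    define k where "k = idx s 4"
    let ?a = "schedule N \<alpha> \<beta> d (Suc k)"
    have env: "env N \<alpha> \<beta> d i s" and k: "i \<le> k" "k < N" "n = N - k"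
      and time: "t' \<le> t + 6 * (k - i)"
      using I less by (auto simp: k_def env_def)
    have "{i<..Suc k} = insert (Suc k) {i<..k}"
      using k by auto
    then have num: "c - \<alpha> * (\<Sum>j\<in>{i<..Suc k}. max 0 (d i - schedule N \<alpha> \<beta> d j))
        = arr s 4 0 - \<alpha> * max 0 (d i - ?a)"
      using I by (simp add: k_def algebra_simps)
    have user: "arr s (Suc 0) i = d i" "arr s 2 (Suc k) = ?a" "idx s 4 = k"
      using env \<open>i \<in> {1..N}\<close> k by (auto simp: env_def k_def)
    show "n > 0 \<and> wp rhs_body (?I (n - 1)) (Suc t') s"
      using env k time \<open>i \<in> {1..N}\<close>
      by (auto simp: rhs_body_def env_def set_idx_def num user)
  next
    fix n t' s assume I: "?I n t' s" and "\<not> holds (ILess 4 0) s"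
    then have "idx s 4 = N" by (auto simp: env_def)
    with I show "Q (Suc t') s" by (intro Q) auto
  qed (use assms in auto)
qed

lemma wp_min_loop:
  assumes "env N \<alpha> \<beta> d i s" "i \<in> {1..N}" "\<alpha> > 0" and rate: "\<alpha> * (real N - 1) < \<beta>"
    and "idx s 4 = i - 1" "arr s 4 0 = c" "arr s 5 0 = \<beta>" "arr s 6 0 = c / \<beta>"
    and Q: "\<And>t' s'. \<lbrakk>env N \<alpha> \<beta> d i s'; t' \<le> t + 8 * N + 1;
      arr s' 6 0 = Min (line_root \<alpha> \<beta> d i c ` {1..i})\<rbrakk> \<Longrightarrow> Q t' s'"
  shows "wp (Loop (ILess 1 4) min_body) Q t s"
proof -
  \<comment> \<open>\<open>Suc (idx s 4)\<close> is the last k treated; the initial root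
    \<open>c / \<beta>\<close> is the case k = i. A round costs at most 8: two tests, four
    arithmetic operations, one copy and one decrement.\<close>
  let ?I = "\<lambda>n t' s. env N \<alpha> \<beta> d i s \<and> idx s 4 < i \<and> n = idx s 4 \<and>
    arr s 4 0 = c - \<alpha> * (\<Sum>j=Suc (idx s 4)..<i. d j) \<and>
    arr s 5 0 = \<beta> - \<alpha> * (real i - real (Suc (idx s 4))) \<and>
    arr s 6 0 = Min (line_root \<alpha> \<beta> d i c ` {Suc (idx s 4)..i}) \<and>
    t' \<le> t + 8 * (i - Suc (idx s 4))"
  show ?thesis
  proof (rule wp_Loop[where I = ?I and n = "i - 1"])
    show "?I (i - 1) t s"
      using assms by (auto simp: line_root_def)
  next
    fix n t' s assume I: "?I n t' s" and less: "holds (ILess 1 4) s"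
    define k where "k = idx s 4"
    have k: "1 \<le> k" "k < i" "k \<in> {1..N}"
      using I less \<open>i \<in> {1..N}\<close> by (auto simp: k_def env_def)
    \<comment> \<open>A positive denominator keeps the division from getting stuck.\<close>
    have "\<alpha> * (real i - real k) \<le> \<alpha> * (real N - 1)"
      using k \<open>i \<in> {1..N}\<close> \<open>\<alpha> > 0\<close> by (intro mult_left_mono) auto
    then have den: "\<beta> - \<alpha> * (real i - real k) > 0" using rate by linarith
    have num_eq: "arr s 4 0 - \<alpha> * d k = c - \<alpha> * (\<Sum>j=k..<i. d j)"
      using I k by (simp add: k_def[symmetric] sum.atLeast_Suc_lessThan[of k i] algebra_simps)
    have den_eq: "arr s 5 0 - \<alpha> = \<beta> - \<alpha> * (real i - real k)"
      using I k by (simp add: k_def[symmetric] algebra_simps)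
    have root_eq: "(arr s 4 0 - \<alpha> * d k) / (arr s 5 0 - \<alpha>) = line_root \<alpha> \<beta> d i c k"
      by (simp only: num_eq den_eq line_root_def)
    have "{k..i} = insert k {Suc k..i}"
      using k by auto
    then have Min_eq: "Min (line_root \<alpha> \<beta> d i c ` {k..i}) = min (line_root \<alpha> \<beta> d i c k) (arr s 6 0)"
      using I k by (simp add: k_def[symmetric])
    have idx: "idx s 4 = k" "Suc (k - Suc 0) = k" using k by (auto simp: k_def)
    have env: "env N \<alpha> \<beta> d i s" and time: "n = k" "t' \<le> t + 8 * (i - Suc k)"
      using I by (auto simp: k_def)
    show "n > 0 \<and> wp min_body (?I (n - 1)) (Suc t') s"
      using env time k den num_eq[symmetric] den_eq[symmetric] root_eq Min_eq
      by (auto simp: min_body_def env_def set_idx_def idx)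
  next
    fix n t' s assume I: "?I n t' s" and "\<not> holds (ILess 1 4) s"
    then have "idx s 4 = 0" by (auto simp: env_def)
    with I \<open>i \<in> {1..N}\<close> show "Q (Suc t') s" by (intro Q) auto
  qed
qed

lemma wp_user_body:
  assumes "env N \<alpha> \<beta> d i s" and i: "i \<in> {1..N}" and "\<alpha> > 0" and rate: "\<alpha> * (real N - 1) < \<beta>"
    and Q: "\<And>t' s'. \<lbrakk>env N \<alpha> \<beta> d (i - 1) s'; t' \<le> t + 14 * N + 11\<rbrakk> \<Longrightarrow> Q t' s'"
  shows "wp user_body Q t s"
proof -
  have "0 \<le> \<alpha> * (real N - 1)"
    using \<open>\<alpha> > 0\<close> i by (intro mult_nonneg_nonneg) auto
  then have "\<beta> \<noteq> 0" using rate by linarith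
  let ?c = "\<beta> * d i - 1 - \<alpha> * (\<Sum>j\<in>{i<..N}. max 0 (d i - schedule N \<alpha> \<beta> d j))"
  \<comment> \<open>Nine single operations and the loop bounds \<open>6 * N + 1\<close> and
    \<open>8 * N + 1\<close> add up to \<open>14 * N + 11\<close>.\<close>
  show ?thesis
    unfolding user_body_def wp_Seq wp_simps wp_RArith
    apply (intro conjI)
      apply simp
     apply simp
    apply (rule wp_rhs_loop[where N = N and \<alpha> = \<alpha> and \<beta> = \<beta> and d = d and i = i
          and c = "\<beta> * d i - 1"])
        apply (use assms in \<open>auto simp: env_def set_idx_def\<close>)[4]
    apply (intro conjI)
    subgoal using \<open>\<beta> \<noteq> 0\<close> by (auto simp: env_def)
    apply (rule wp_min_loop[where N = N and \<alpha> = \<alpha> and \<beta> = \<beta> and d = d and i = i and c = ?c])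
            apply (use assms in \<open>auto simp: env_def set_idx_def\<close>)[8]
    \<comment> \<open>Storing the minimum in cell i of array 2 extends the known arrivals to
      \<open>{i - 1<..N}\<close>.\<close>
    apply (rule Q)
     apply (use i in \<open>auto simp: env_def set_idx_def schedule.simps[of N \<alpha> \<beta> d i]\<close>)
    done
qed

lemma wp_schedule_prog:
  assumes "\<alpha> > 0" and "\<alpha> * (real N - 1) < \<beta>"
  shows "wp schedule_prog (\<lambda>t s. t \<le> 14 * N\<^sup>2 + 12 * N + 4 \<and>
    output_vec N s = restrict (schedule N \<alpha> \<beta> d) {1..N}) 0 (input_state N \<alpha> \<beta> d)"
proof -
  \<comment> \<open>Users after n are done. Initialization costs 3, each round
    \<open>14 * N + 12\<close> including its test, and the failing last test costs 1.\<close>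
  let ?I = "\<lambda>n t s. n \<le> N \<and> env N \<alpha> \<beta> d n s \<and> t \<le> 3 + (N - n) * (14 * N + 12)"
  show ?thesis
    unfolding schedule_prog_def wp_Seq wp_simps
  proof (rule wp_Loop[where I = ?I and n = N])
    fix n t s assume I: "?I n t s" and less: "holds (ILess 1 3) s"
    then have n: "n \<in> {1..N}" by (auto simp: env_def)
    then have "N - (n - 1) = Suc (N - n)" by auto
    with I n show "n > 0 \<and> wp user_body (?I (n - 1)) (Suc t) s"
      by (auto intro!: wp_user_body[OF _ n assms])
  next
    fix n t s assume I: "?I n t s" and "\<not> holds (ILess 1 3) s"
    then have "n = 0" by (auto simp: env_def)
    with I show "Suc t \<le> 14 * N\<^sup>2 + 12 * N + 4 \<and>
        output_vec N s = restrict (schedule N \<alpha> \<beta> d) {1..N}"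
      by (auto simp: env_def output_vec_def power2_eq_square algebra_simps intro!: restrict_ext)
  qed (auto simp: env_def input_state_def set_idx_def)
qed

theorem corollary3p3:
  "\<exists>(c :: prog) (p :: nat poly).
     \<forall>(N :: nat) (\<alpha> :: real) (\<beta> :: real) (dstar :: nat \<Rightarrow> real).
       N \<ge> 1 \<and> \<alpha> > 0 \<and> \<beta> > 0 \<and> real N < \<beta> / \<alpha> + 1 \<and>
       dstar \<in> rvec N \<and> mono_on {1..N} dstar \<longrightarrow>
       (\<exists>a0 T s.
          optimal_schedule N \<alpha> \<beta> 0 dstar a0 \<and>
          (\<forall>a. optimal_schedule N \<alpha> \<beta> 0 dstar a \<longrightarrow> a = a0) \<and>
          total_cost N \<alpha> \<beta> 0 dstar a0 = 0 \<and>
          exec c (input_state N \<alpha> \<beta> dstar) T s \<and>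
          output_vec N s = a0 \<and>
          T \<le> poly p N)"
\<comment> \<open>The polynomial is the time bound of \<open>wp_schedule_prog\<close>, constant
  coefficient first.\<close>
proof (rule exI[of _ schedule_prog], rule exI[of _ "[:4, 12, 14:]"], intro allI impI, elim conjE)
  fix N :: nat and \<alpha> \<beta> :: real and dstar :: "nat \<Rightarrow> real"
  assume "\<alpha> > 0" "real N < \<beta> / \<alpha> + 1" and dstar: "dstar \<in> rvec N" "mono_on {1..N} dstar"
  then have rate: "\<alpha> * (real N - 1) < \<beta>"
    by (simp add: field_simps)
  obtain T s where run: "exec schedule_prog (input_state N \<alpha> \<beta> dstar) T s"
    and T: "T \<le> 14 * N\<^sup>2 + 12 * N + 4" and out: "output_vec N s = restrict (schedule N \<alpha> \<beta> dstar) {1..N}"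
    using wp_schedule_prog[OF \<open>\<alpha> > 0\<close> rate, of dstar] by (auto simp: wp_def)
  have "T \<le> poly [:4, 12, 14:] N"
    using T by (simp add: power2_eq_square algebra_simps)
  with run out show "\<exists>a0 T s.
          optimal_schedule N \<alpha> \<beta> 0 dstar a0 \<and>
          (\<forall>a. optimal_schedule N \<alpha> \<beta> 0 dstar a \<longrightarrow> a = a0) \<and>
          total_cost N \<alpha> \<beta> 0 dstar a0 = 0 \<and>
          exec schedule_prog (input_state N \<alpha> \<beta> dstar) T s \<and>
          output_vec N s = a0 \<and>
          T \<le> poly [:4, 12, 14:] N"
    unfolding optimal_schedule_iff(1)[OF \<open>\<alpha> > 0\<close> rate dstar]
    using optimal_schedule_iff(2)[OF \<open>\<alpha> > 0\<close> rate dstar] by blast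
qed

end
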